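(* Let $U$ be an $n\times n$ matrix of the form $$U=\sum_{s=0}^k D_{C_s}F(\mathcal R_s)+D_{\Gamma_s}D_{p_s}F(\mathcal R_s)D_{q_s},$$ where $\mathcal R_0\prec\cdots\prec\mathcal R_k$ is a filtration of $\{1,\dots,n\}$ with $\mathcal R_0$ the trivial partition and $\mathcal R_k$ the partition into singletons, $C_s,\Gamma_s$ are nonnegative $\mathcal R_s$-measurable vectors, $\Gamma_k=0$, and for $s\le k-1$ $\{p_s,q_s\}$ is an $\mathcal R_{s+1}$-measurable partition. Let $\mathbb E_s$, $c_s$, $\gamma_s$, $\rho_s$ be the associated conditional expectations, normalized factors and functions defined in the context. Assume that the backward recursion, for $s=k-1,\dots,0$, $$\frac1{d_s}=\mathbb E_s\!\left(\frac1{c_{s+1}+d_{s+1}}\right)-\gamma_s\,\mathbb E_s\!\left(\frac{p_s}{c_{s+1}+d_{s+1}}\right)\mathbb E_s\!\left(\frac{q_s}{c_{s+1}+d_{s+1}}\right)$$ starting with $d_k=\mathbf 1$ has a nonnegative solution $d_k,\dots,d_0$, and that this solution satisfies for $s=k-1,\dots,0$ $$\rho_s\gamma_s\le c_{s+1}+d_{s+1}.$$ Define $l_k=m_k=\lambda_k=\mu_k=\mathbf 1$, $\sigma_s=(1+c_s/d_s)^{-1}$ for $s=k,\dots,0$, and recursively for $s=k-1,\dots,0$ $$\lambda_s=\sigma_{s+1}l_{s+1},\quad l_s=\lambda_s\Big[1-\gamma_sp_s\mathbb E_s\Big(\frac{q_s}{c_{s+1}+d_{s+1}}\Big)\Big],$$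 $$\mu_s=\sigma_{s+1}m_{s+1},\quad m_s=\mu_s\Big[1-\gamma_sq_s\mathbb E_s\Big(\frac{p_s}{c_{s+1}+d_{s+1}}\Big)\Big],$$ and $\lambda_{-1}=\sigma_0l_0$, $\mu_{-1}=\sigma_0m_0$. Then $\lambda_s,l_s,\mu_s,m_s,\sigma_s$ for $s=k,\dots,0$, as well as $\lambda_{-1},\mu_{-1}$, are well defined and nonnegative. Consequently $\mathbb I+U$ is a bi-potential, and its inverse is $\mathbb I-N$, where $$N=\sum_{s=0}^k c_s\sigma_sl_s\,\mathbb E_s\,m_s+\sum_{s=0}^{k-1}\gamma_s\lambda_sp_s\,\mathbb E_s\,q_s\mu_s .$$
   Context: A partition $\mathcal R$ of $\{1,\dots,n\}$ has atoms (its blocks); $\mathcal R\prec\mathcal Q$ means $\mathcal R\ne\mathcal Q$ and every atom of $\mathcal Q$ is contained in an atom of $\mathcal R$. A filtration is a strictly increasing sequence $\mathcal R_0\prec\cdots\prec\mathcal R_k$. $F(\mathcal R)$ is the $0/1$ matrix with $F(\mathcal R)_{ij}=1$ iff $i,j$ are in the same atom of $\mathcal R$. A vector is $\mathcal R$-measurable if it is constant on atoms of $\mathcal R$. $\{p_s,q_s\}$ is an $\mathcal R_{s+1}$-measurable partition if $p_s,q_s$ are $\{0,1\}$-valued $\mathcal R_{s+1}$-measurable vectors with $p_s\odot q_s=0$ and $p_s+q_s=\mathbf 1$. $D_v$ is the diagonal matrix with diagonal $v$; $\odot$ is the entrywise product; $\mathbb I$ is the identity matrix; $\mathbf 1$ is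 the vector of ones. Since $\Gamma_k=0$, the term with $p_k,q_k$ is absent. $\mathbb E_s=D_{F(\mathcal R_s)\mathbf 1}^{-1}F(\mathcal R_s)$ is the conditional expectation (averaging over atoms) for $\mathcal R_s$; $c_s=C_s\odot F(\mathcal R_s)\mathbf 1$, $\gamma_s=\Gamma_s\odot F(\mathcal R_s)\mathbf 1$, so that $U=\sum_{s=0}^k c_s\mathbb E_s+\gamma_sp_s\mathbb E_sq_s$; $\rho_s=\mathbb E_s(p_s)p_s+\mathbb E_s(q_s)q_s$. Vectors are treated as functions on $\{1,\dots,n\}$: products, quotients and inequalities of vectors are componentwise. In a product involving the operator $\mathbb E_s$ (such as $a\,\mathbb E_s\,b$) a vector stands for the operator of multiplication by it, i.e. $a\,\mathbb E_s\,b=D_a\mathbb E_sD_b$, while $\mathbb E_s(v)$ is the vector obtained by applying $\mathbb E_s$ to $v$. Components of $d_s$ may a priori take the value $\infty$ ($1/\infty=0$), and the conventions $0\cdot\infty=0/0=0$ are used. A nonnegative matrix $V$ is a bi-potential if it is nonsingular and $(V^{-1})_{ij}\le 0$ for $i\neq j$, $(V^{-1})_{ii}>0$, $\sum_j (V^{-1})_{ij}\ge 0$ for every $i$, and $\sum_i (V^{-1})_{ij}\ge 0$ for every $j$. *)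

theory Defs
  imports "HOL-Analysis.Analysis"
begin

text \<open>
  The index set \<open>{1,\<dots>,n}\<close> is a finite type \<open>'n\<close>. On \<^typ>\<open>real^'n\<close> the operations \<open>*\<close>, \<open>\<le>\<close>
  and the constant \<open>1\<close> are componentwise, so \<open>*\<close> is the entrywise product of vectors.
\<close>

definition coarser :: "'n set set \<Rightarrow> 'n set set \<Rightarrow> bool" where
  "coarser R Q \<longleftrightarrow> R \<noteq> Q \<and> (\<forall>B\<in>Q. \<exists>A\<in>R. B \<subseteq> A)"

definition filtration :: "nat \<Rightarrow> (nat \<Rightarrow> 'n set set) \<Rightarrow> bool" where
  "filtration k R \<longleftrightarrow>
     (\<forall>s\<le>k. partition_on UNIV (R s)) \<and> (\<forall>s<k. coarser (R s) (R (Suc s)))"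

definition measurable_vec :: "'n set set \<Rightarrow> real^'n \<Rightarrow> bool" where
  "measurable_vec R v \<longleftrightarrow> (\<forall>A\<in>R. \<forall>i\<in>A. \<forall>j\<in>A. v $ i = v $ j)"

definition measurable_partition :: "'n set set \<Rightarrow> real^'n \<Rightarrow> real^'n \<Rightarrow> bool" where
  "measurable_partition R p q \<longleftrightarrow>
     (\<forall>i. p $ i \<in> {0, 1}) \<and> (\<forall>i. q $ i \<in> {0, 1}) \<and>
     measurable_vec R p \<and> measurable_vec R q \<and> p * q = 0 \<and> p + q = 1"

definition F :: "'n set set \<Rightarrow> real^'n^'n" where
  "F R = (\<chi> i j. if \<exists>A\<in>R. i \<in> A \<and> j \<in> A then 1 else 0)"

definition D :: "real^'n \<Rightarrow> real^'n^'n" where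
  "D v = (\<chi> i j. if i = j then v $ i else 0)"

definition condexp :: "'n::finite set set \<Rightarrow> real^'n^'n" where
  "condexp R = matrix_inv (D (F R *v 1)) ** F R"

text \<open>
  The same operator on functions with extended real values. In \<^typ>\<open>ereal\<close> one has
  \<open>0 * \<infinity> = 0 / 0 = 0\<close>, \<open>1 / \<infinity> = 0\<close> and \<open>1 / 0 = \<infinity>\<close>.
\<close>

definition econdexp :: "'n::finite set set \<Rightarrow> ('n \<Rightarrow> ereal) \<Rightarrow> 'n \<Rightarrow> ereal" where
  "econdexp R f i = (\<Sum>j\<in>UNIV. ereal (condexp R $ i $ j) * f j)"

definition real_vec :: "('n \<Rightarrow> ereal) \<Rightarrow> real^'n" where
  "real_vec f = (\<chi> i. real_of_ereal (f i))"

definition bi_potential :: "real^'n^'n \<Rightarrow> bool" where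
  "bi_potential V \<longleftrightarrow>
     (\<forall>i j. 0 \<le> V $ i $ j) \<and> invertible V \<and>
     (\<forall>i j. i \<noteq> j \<longrightarrow> matrix_inv V $ i $ j \<le> 0) \<and>
     (\<forall>i. 0 < matrix_inv V $ i $ i) \<and>
     (\<forall>i. 0 \<le> (\<Sum>j\<in>UNIV. matrix_inv V $ i $ j)) \<and>
     (\<forall>j. 0 \<le> (\<Sum>i\<in>UNIV. matrix_inv V $ i $ j))"

end

(*
  Start from the identity and add the terms of U from the finest partition to the coarsest, for
  each s first the term with p_s, q_s and then c_s E_s. The matrix obtained so far is block
  diagonal with respect to R_{s+1} (respectively R_s), hence so is its inverse V', and therefore
  V' E_s = D(V' 1) E_s and E_s V' = E_s D(1 V'): only the row sums (lambda_s, then l_s) and the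
  column sums (mu_s, then m_s) of V' enter the update of the inverse. These sums satisfy the
  stated recursions because E_s(l_s) = E_s(m_s) = 1 / d_s and
  E_{s+1}(lambda_s) = E_{s+1}(mu_s) = 1 / (c_{s+1} + d_{s+1}). The bound on rho_s gamma_s, averaged
  over the atoms of R_s, keeps them nonnegative.

  Only the reciprocals r_s = 1 / d_s and w_s = 1 / (c_s + d_s) enter, and they are finite even
  where d_s is infinite, so the argument is carried out over the reals.
*)

theory Submission
  imports Defs
begin

section \<open>Block-diagonal matrices, diagonal scalings and measurable vectors\<close>

definition local_matrix :: "'n set set \<Rightarrow> real^'n^'n \<Rightarrow> bool" where
  "local_matrix R X \<longleftrightarrow> (\<forall>i j. F R $ i $ j = 0 \<longrightarrow> X $ i $ j = 0)"

lemma F_eq_0_iff: "F R $ i $ j = 0 \<longleftrightarrow> \<not> (\<exists>A\<in>R. i \<in> A \<and> j \<in> A)"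
  by (simp add: F_def)

lemma F_coarser_eq_0: "coarser R Q \<Longrightarrow> F R $ i $ j = 0 \<Longrightarrow> F Q $ i $ j = 0"
  unfolding F_eq_0_iff coarser_def by (meson subsetD)

lemma D_nth: "D v $ i $ j = (if i = j then v $ i else 0)"
  by (simp add: D_def)

lemma D_mult_nth: "(D v ** X) $ i $ j = v $ i * X $ i $ j"
  by (simp add: matrix_matrix_mult_def D_nth if_distribR if_distrib[of "\<lambda>x. x * _"] cong: if_cong)

lemma mult_D_nth: "(X ** D v) $ i $ j = X $ i $ j * v $ j"
  by (simp add: matrix_matrix_mult_def D_nth if_distrib cong: if_cong)

lemma D_mult_D: "D a ** D b = D (a * b)"
  by (simp add: vec_eq_iff D_mult_nth D_nth)

lemma D_one: "D 1 = mat 1"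
  by (simp add: vec_eq_iff D_nth mat_def)

lemma D_zero: "D 0 = 0"
  by (simp add: vec_eq_iff D_nth)

lemma D_add: "D (a + b) = D a + D b"
  by (simp add: vec_eq_iff D_nth)

lemma D_mult_vec: "D a *v x = a * x"
  by (simp add: vec_eq_iff matrix_vector_mult_def D_nth if_distrib[of "\<lambda>x. x * _"] cong: if_cong)

lemma vec_mult_D: "x v* D a = x * a"
  by (simp add: vec_eq_iff vector_matrix_mult_def D_nth if_distrib[of "\<lambda>x. x * _"]
      if_distrib[of "\<lambda>x. _ * x"] mult.commute cong: if_cong)

lemma vec_mult_matrix_assoc: "x v* (A ** B) = (x v* A) v* (B :: real^'n^'m)"
  by (simp flip: transpose_matrix_vector add: matrix_transpose_mul matrix_vector_mul_assoc)

lemma vec_mult_matrix_diff: "x v* (A - B) = x v* A - x v* (B :: real^'n^'m)"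
  by (simp add: vec_eq_iff vector_matrix_mult_def sum_subtractf algebra_simps)

lemma matrix_vec_mult_diff: "(A - B) *v x = A *v x - (B :: real^'n^'m) *v x"
  by (simp add: vec_eq_iff matrix_vector_mult_def sum_subtractf algebra_simps)

lemma matrix_mult_diff_distrib_left: "A ** (B - C) = A ** B - A ** (C :: real^'n^'m)"
  by (simp add: vec_eq_iff matrix_matrix_mult_def sum_subtractf algebra_simps)

lemma matrix_mult_add_distrib_right: "(A + B) ** C = A ** C + B ** (C :: real^'n^'m)"
  by (simp add: vec_eq_iff matrix_matrix_mult_def sum.distrib algebra_simps)

lemma matrix_inv_unique:
  fixes A :: "'a::semiring_1^'n^'m"
  assumes "A ** B = mat 1" "B ** A = mat 1"
  shows "matrix_inv A = B"
proof -
  have "\<exists>B. A ** B = mat 1 \<and> B ** A = mat 1" using assms by blast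
  then have *: "matrix_inv A ** A = mat 1" unfolding matrix_inv_def by (rule someI2_ex) blast
  have "matrix_inv A = matrix_inv A ** (A ** B)" by (simp add: assms(1))
  also have "\<dots> = B" by (simp add: matrix_mul_assoc *)
  finally show ?thesis .
qed

lemma matrix_mult_one_nth: "(X *v 1) $ i = (\<Sum>j\<in>UNIV. X $ i $ (j :: 'n :: finite) :: real)"
  by (simp add: matrix_vector_mult_def)

lemma one_mult_matrix_nth: "(1 v* X) $ j = (\<Sum>i\<in>UNIV. X $ i $ j :: real)"
  by (simp add: vector_matrix_mult_def)

lemma local_matrix_mat: "partition_on UNIV R \<Longrightarrow> local_matrix R (mat 1)"
  unfolding local_matrix_def F_eq_0_iff mat_def partition_on_def by auto

lemma local_matrix_add: "local_matrix R X \<Longrightarrow> local_matrix R Y \<Longrightarrow> local_matrix R (X + Y)"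
  by (simp add: local_matrix_def)

lemma local_matrix_diff: "local_matrix R X \<Longrightarrow> local_matrix R Y \<Longrightarrow> local_matrix R (X - Y)"
  by (simp add: local_matrix_def)

lemma local_matrix_D_mult: "local_matrix R X \<Longrightarrow> local_matrix R (D a ** X)"
  by (simp add: local_matrix_def D_mult_nth)

lemma local_matrix_mult_D: "local_matrix R X \<Longrightarrow> local_matrix R (X ** D a)"
  by (simp add: local_matrix_def mult_D_nth)

lemma local_matrix_coarser: "local_matrix Q X \<Longrightarrow> coarser R Q \<Longrightarrow> local_matrix R X"
  by (simp add: local_matrix_def F_coarser_eq_0)

lemma measurable_vecD:
  "measurable_vec R v \<Longrightarrow> A \<in> R \<Longrightarrow> i \<in> A \<Longrightarrow> j \<in> A \<Longrightarrow> v $ i = v $ j"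
  unfolding measurable_vec_def by blast

lemma measurable_vecI:
  "(\<And>A i j. A \<in> R \<Longrightarrow> i \<in> A \<Longrightarrow> j \<in> A \<Longrightarrow> v $ i = v $ j) \<Longrightarrow> measurable_vec R v"
  unfolding measurable_vec_def by (intro ballI)

lemma measurable_vec_coarser:
  assumes "measurable_vec R v" "coarser R Q"
  shows "measurable_vec Q v"
proof (rule measurable_vecI)
  fix B i j assume "B \<in> Q" "i \<in> B" "j \<in> B"
  moreover from \<open>B \<in> Q\<close> obtain A where "A \<in> R" "B \<subseteq> A"
    using assms(2) unfolding coarser_def by blast
  ultimately show "v $ i = v $ j" using measurable_vecD[OF assms(1)] by blast
qed

lemma measurable_vec_mult: "measurable_vec R a \<Longrightarrow> measurable_vec R b \<Longrightarrow> measurable_vec R (a * b)"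
  by (rule measurable_vecI)
    (simp only: vector_mult_component, rule arg_cong2[of _ _ _ _ times]; rule measurable_vecD)

text \<open>On each diagonal block of \<open>X\<close> the vector \<open>a\<close> is constant, so
  \<open>D a\<close> acts there as a scalar.\<close>

lemma local_matrix_commute_D:
  assumes "local_matrix R X" "measurable_vec R a"
  shows "X ** D a = D a ** X"
proof -
  have "X $ i $ j * a $ j = a $ i * X $ i $ j" for i j
  proof (cases "F R $ i $ j = 0")
    case True
    with assms(1) show ?thesis by (simp add: local_matrix_def)
  next
    case False
    then obtain A where "A \<in> R" "i \<in> A" "j \<in> A" by (auto simp: F_eq_0_iff)
    then have "a $ i = a $ j" using measurable_vecD[OF assms(2)] by blast
    then show ?thesis by simp
  qed
  then show ?thesis by (simp add: vec_eq_iff D_mult_nth mult_D_nth)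
qed

section \<open>Conditional expectation with respect to one partition\<close>

context
  fixes R :: "'n::finite set set"
  assumes R: "partition_on UNIV R"
begin

lemma F_nth_cong: "A \<in> R \<Longrightarrow> i \<in> A \<Longrightarrow> j \<in> A \<Longrightarrow> F R $ i $ k = F R $ j $ k"
proof -
  assume A: "A \<in> R" "i \<in> A" "j \<in> A"
  have "B = A" if "B \<in> R" "x \<in> B" "x \<in> A" for B x
    using that A(1) R unfolding partition_on_def disjoint_def by blast
  with A have "(\<exists>B\<in>R. i \<in> B \<and> k \<in> B) = (\<exists>B\<in>R. j \<in> B \<and> k \<in> B)" by metis
  then show ?thesis by (simp add: F_def)
qed

lemma F_sym: "F R $ i $ j = F R $ j $ i"
  unfolding F_def by auto

lemma F_nonneg: "0 \<le> F R $ i $ j"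
  unfolding F_def by auto

lemma F_one_pos: "0 < (F R *v 1) $ i"
proof -
  have "F R $ i $ i = 1"
    using R unfolding F_def partition_on_def by auto
  then show ?thesis
    unfolding matrix_mult_one_nth
    by (intro sum_pos2[of _ i]) (auto simp: F_nonneg)
qed

lemma F_one_nonzero: "(F R *v 1) $ i \<noteq> 0"
  using F_one_pos[of i] by simp

lemma condexp_nth: "condexp R $ i $ j = F R $ i $ j / (F R *v 1) $ i"
proof -
  \<comment> \<open>The entries of \<open>?v\<close> are the sizes of the atoms, hence positive, so
    the inverse of \<open>D ?v\<close> is formed by entrywise reciprocals.\<close>
  let ?v = "F R *v 1" and ?w = "\<chi> i. 1 / (F R *v 1) $ i"
  have "?v * ?w = 1" "?w * ?v = 1"
    by (simp_all add: vec_eq_iff F_one_nonzero)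
  then have "matrix_inv (D ?v) = D ?w"
    by (metis D_mult_D D_one matrix_inv_unique)
  then show ?thesis
    unfolding condexp_def by (simp add: D_mult_nth)
qed

lemma F_one_cong: "A \<in> R \<Longrightarrow> i \<in> A \<Longrightarrow> j \<in> A \<Longrightarrow> (F R *v 1) $ i = (F R *v 1) $ j"
  using F_nth_cong[of A i j] unfolding matrix_mult_one_nth by simp

lemma measurable_vec_F_one: "measurable_vec R (F R *v 1)"
  by (rule measurable_vecI) (rule F_one_cong)

lemma condexp_cong: "A \<in> R \<Longrightarrow> i \<in> A \<Longrightarrow> j \<in> A \<Longrightarrow> condexp R $ i $ k = condexp R $ j $ k"
  using F_nth_cong[of A i j] F_one_cong[of A i j] by (simp add: condexp_nth)

lemma condexp_nonneg: "0 \<le> condexp R $ i $ j"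
  using F_nonneg F_one_pos by (simp add: condexp_nth less_imp_le)

lemma local_matrix_condexp: "local_matrix R (condexp R)"
  by (simp add: local_matrix_def condexp_nth)

text \<open>\<open>F R\<close> is symmetric, and the normalizing atom sizes at \<open>i\<close> and
  \<open>j\<close> agree unless the entry vanishes. This lets statements about rows be transferred
  to columns.\<close>

lemma condexp_sym: "condexp R $ i $ j = condexp R $ j $ i"
proof (cases "F R $ i $ j = 0")
  case True
  then show ?thesis by (simp add: condexp_nth F_sym[of j i])
next
  case False
  then obtain A where "A \<in> R" "i \<in> A" "j \<in> A" by (auto simp: F_eq_0_iff)
  then have "(F R *v 1) $ i = (F R *v 1) $ j" by (rule F_one_cong)
  then show ?thesis by (simp add: condexp_nth F_sym[of j i])
qed

lemma condexp_one: "condexp R *v 1 = 1"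
proof -
  have "(condexp R *v 1) $ i = (F R *v 1) $ i / (F R *v 1) $ i" for i
    by (simp add: matrix_mult_one_nth condexp_nth flip: sum_divide_distrib)
  then show ?thesis
    by (simp_all add: vec_eq_iff F_one_nonzero)
qed

lemma vec_mult_condexp: "x v* condexp R = condexp R *v x"
proof -
  have "transpose (condexp R) = condexp R"
    unfolding vec_eq_iff transpose_def vec_lambda_beta by (intro allI condexp_sym)
  then show ?thesis by (metis transpose_matrix_vector)
qed

lemma measurable_vec_condexp: "measurable_vec R (condexp R *v f)"
proof (rule measurable_vecI)
  fix A i j assume "A \<in> R" "i \<in> A" "j \<in> A"
  then have "condexp R $ i $ k = condexp R $ j $ k" for k by (rule condexp_cong)
  then show "(condexp R *v f) $ i = (condexp R *v f) $ j" by (simp add: matrix_vector_mult_def)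
qed

lemma condexp_mult_measurable:
  assumes "measurable_vec R a"
  shows "condexp R *v (a * f) = a * (condexp R *v f)"
proof -
  have "condexp R ** D a = D a ** condexp R"
    using local_matrix_commute_D[OF local_matrix_condexp assms] .
  then show ?thesis
    by (metis D_mult_vec matrix_vector_mul_assoc)
qed

text \<open>Rows of \<open>condexp R\<close> coincide within an atom, so in the sum over
  \<open>k\<close> the entry of \<open>condexp R\<close> can be taken from row \<open>i\<close> and
  pulled out, leaving a row sum of \<open>X\<close>.\<close>

lemma local_matrix_mult_condexp:
  assumes "local_matrix R X"
  shows "X ** condexp R = D (X *v 1) ** condexp R"
proof -
  have "X $ i $ k * condexp R $ k $ j = X $ i $ k * condexp R $ i $ j" for i j k
  proof (cases "F R $ i $ k = 0")
    case True
    with assms show ?thesis by (simp add: local_matrix_def)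
  next
    case False
    then obtain A where "A \<in> R" "i \<in> A" "k \<in> A" by (auto simp: F_eq_0_iff)
    then show ?thesis by (simp add: condexp_cong[of A i k])
  qed
  then have "(X ** condexp R) $ i $ j = (\<Sum>k\<in>UNIV. X $ i $ k * condexp R $ i $ j)" for i j
    unfolding matrix_matrix_mult_def vec_lambda_beta by (intro sum.cong refl)
  then show ?thesis
    by (simp add: vec_eq_iff D_mult_nth matrix_mult_one_nth sum_distrib_right)
qed

text \<open>The mirror image: by symmetry the columns of \<open>condexp R\<close> also coincide
  within an atom, which leaves the column sums of \<open>X\<close>.\<close>

lemma condexp_mult_local_matrix:
  assumes "local_matrix R X"
  shows "condexp R ** X = condexp R ** D (1 v* X)"
proof -
  have "condexp R $ i $ k * X $ k $ j = condexp R $ i $ j * X $ k $ j" for i j k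
  proof (cases "F R $ k $ j = 0")
    case True
    with assms show ?thesis by (simp add: local_matrix_def)
  next
    case False
    then obtain A where "A \<in> R" "k \<in> A" "j \<in> A" by (auto simp: F_eq_0_iff)
    then show ?thesis by (metis condexp_sym condexp_cong)
  qed
  then have "(condexp R ** X) $ i $ j = (\<Sum>k\<in>UNIV. condexp R $ i $ j * X $ k $ j)" for i j
    unfolding matrix_matrix_mult_def vec_lambda_beta by (intro sum.cong refl)
  then show ?thesis
    by (simp add: vec_eq_iff mult_D_nth one_mult_matrix_nth sum_distrib_left)
qed

text \<open>The factor \<open>condexp R ** D f\<close> is itself block diagonal, and its row sums
  are \<open>condexp R *v f\<close>.\<close>

lemma condexp_D_condexp: "condexp R ** D f ** condexp R = D (condexp R *v f) ** condexp R"
  using local_matrix_mult_condexp[OF local_matrix_mult_D[OF local_matrix_condexp], of f]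
  by (simp add: D_mult_vec flip: matrix_vector_mul_assoc)

lemma condexp_mono:
  assumes "\<And>j. f $ j \<le> g $ j"
  shows "(condexp R *v f) $ i \<le> (condexp R *v g) $ i"
  by (simp add: matrix_vector_mult_def sum_mono mult_left_mono assms condexp_nonneg)

lemma condexp_vec_nonneg: "0 \<le> f \<Longrightarrow> 0 \<le> condexp R *v f"
  using condexp_nonneg by (auto simp: less_eq_vec_def matrix_vector_mult_def intro!: sum_nonneg)

text \<open>The pointwise bound is multiplied by \<open>q\<close> and averaged; then the average of
  \<open>q\<close> is cancelled. Atoms on which that average is 0 are harmless, because there the
  left side vanishes.\<close>

lemma condexp_indicator_mult_le_one:
  assumes g: "measurable_vec R g"
    and q: "\<And>i. q $ i \<in> {0, 1}"
    and le: "\<And>i. q $ i = 1 \<Longrightarrow> (condexp R *v q) $ i * g $ i * w $ i \<le> 1"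
  shows "g $ i * (condexp R *v (q * w)) $ i \<le> 1"
proof (cases "(condexp R *v q) $ i = 0")
  case True
  have "condexp R $ i $ j * q $ j \<ge> 0" for j
    using condexp_nonneg q[of j] by auto
  then have "\<forall>j. condexp R $ i $ j * q $ j = 0"
    using True sum_nonneg_eq_0_iff[of UNIV "\<lambda>j. condexp R $ i $ j * q $ j"]
    by (simp add: matrix_vector_mult_def)
  then have "(condexp R *v (q * w)) $ i = 0"
    by (auto simp: matrix_vector_mult_def intro!: sum.neutral)
  then show ?thesis by simp
next
  case False
  have "0 \<le> q" unfolding less_eq_vec_def
  proof
    show "0 $ i \<le> q $ i" for i using q[of i] by auto
  qed
  then have "0 \<le> (condexp R *v q) $ i"
    using condexp_vec_nonneg[of q] by (simp add: less_eq_vec_def)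
  with False have pos: "0 < (condexp R *v q) $ i" by simp
  \<comment> \<open>\<open>?h\<close> is constant on atoms and therefore comes out of the average.
    Pointwise \<open>?h * (q * w)\<close> is at most \<open>q\<close>: this is \<open>le\<close>
    where \<open>q\<close> is 1, and both sides are 0 elsewhere.\<close>
  let ?h = "(condexp R *v q) * g"
  have "(condexp R *v (?h * (q * w))) $ i \<le> (condexp R *v q) $ i"
  proof (rule condexp_mono)
    show "(?h * (q * w)) $ j \<le> q $ j" for j
      using q[of j] le[of j] by auto
  qed
  also have "condexp R *v (?h * (q * w)) = ?h * (condexp R *v (q * w))"
    by (intro condexp_mult_measurable measurable_vec_mult measurable_vec_condexp g)
  finally have "(condexp R *v q) $ i * (g $ i * (condexp R *v (q * w)) $ i) \<le> (condexp R *v q) $ i"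
    by (simp add: mult.assoc)
  with pos show ?thesis by simp
qed

end

text \<open>\<open>condexp Q\<close> is block diagonal for the coarser \<open>R\<close> as well, and
  its column sums are 1, so it is absorbed by \<open>condexp R\<close>.\<close>

lemma condexp_tower:
  assumes "partition_on UNIV R" "partition_on UNIV Q" "coarser R Q"
  shows "condexp R *v (condexp Q *v f) = condexp R *v f"
proof -
  have "local_matrix R (condexp Q)"
    using local_matrix_coarser[OF local_matrix_condexp] assms by blast
  then have "condexp R ** condexp Q = condexp R"
    using condexp_mult_local_matrix[OF assms(1)] assms(2)
    by (simp add: vec_mult_condexp condexp_one D_one)
  then show ?thesis by (simp add: matrix_vector_mul_assoc)
qed

section \<open>Updating a block-diagonal inverse together with its row and column sums\<close>

definition partial_inverse ::
  "'n set set \<Rightarrow> real^'n^'n \<Rightarrow> real^'n^'n \<Rightarrow> real^'n \<Rightarrow> real^'n \<Rightarrow> bool" where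
  "partial_inverse Q V V' a b \<longleftrightarrow>
     V ** V' = mat 1 \<and> local_matrix Q V \<and> local_matrix Q V' \<and> V' *v 1 = a \<and> 1 v* V' = b"

text \<open>Since \<open>p * q = 0\<close>, the Neumann series of the perturbation stops after its linear term.\<close>

lemma partial_inverse_update_pq:
  assumes R: "partition_on UNIV R" and Q: "coarser R Q"
    and partial: "partial_inverse Q V V' lam mu"
    and p: "measurable_vec Q p" and q: "measurable_vec Q q" and pq: "p * q = 0"
    and g: "measurable_vec R g"
  shows "partial_inverse R (V + D (g * p) ** condexp R ** D q)
    (V' - D (g * lam * p) ** condexp R ** D (q * mu))
    (lam * (1 - g * p * (condexp R *v (q * mu)))) (mu * (1 - g * q * (condexp R *v (p * lam))))"
proof -
  let ?E = "condexp R"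
  define W W' where "W = V + D (g * p) ** ?E ** D q"
    and "W' = V' - D (g * lam * p) ** ?E ** D (q * mu)"
  have V: "local_matrix Q V" and V': "local_matrix Q V'" and inv: "V ** V' = mat 1"
    and lam: "V' *v 1 = lam" and mu: "1 v* V' = mu"
    using partial unfolding partial_inverse_def by auto
  have loc: "local_matrix R V" "local_matrix R V'"
    using V V' Q local_matrix_coarser by blast+
  \<comment> \<open>\<open>q\<close> is measurable only for the finer \<open>Q\<close>, so it is
    moved past \<open>V'\<close> rather than past \<open>?E\<close>; then \<open>V'\<close>
    collapses against \<open>?E\<close> to its column sums.\<close>
  have "?E ** D q ** V' = ?E ** V' ** D q"
    by (simp add: local_matrix_commute_D[OF V' q] flip: matrix_mul_assoc)
  also have "\<dots> = ?E ** D (q * mu)"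
    by (simp add: condexp_mult_local_matrix[OF R loc(2)] mu D_mult_D mult.commute flip: matrix_mul_assoc)
  finally have 1: "?E ** D q ** V' = ?E ** D (q * mu)" .
  have gp: "measurable_vec Q (g * p)"
    using measurable_vec_mult[OF measurable_vec_coarser[OF g Q] p] .
  \<comment> \<open>On the other side \<open>D (g * p)\<close> moves past \<open>V\<close>, and
    \<open>D lam ** ?E\<close> is read back as \<open>V' ** ?E\<close>, so that \<open>V\<close> and
    \<open>V'\<close> cancel.\<close>
  have "V ** D (g * lam * p) ** ?E = V ** D (g * p) ** D lam ** ?E"
    by (simp add: D_mult_D mult_ac flip: matrix_mul_assoc)
  also have "\<dots> = D (g * p) ** (V ** (D lam ** ?E))"
    by (simp add: local_matrix_commute_D[OF V gp] matrix_mul_assoc)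
  also have "D lam ** ?E = V' ** ?E"
    by (simp add: local_matrix_mult_condexp[OF R loc(2)] lam)
  finally have 2: "V ** D (g * lam * p) ** ?E = D (g * p) ** ?E"
    by (simp add: matrix_mul_assoc inv)
  \<comment> \<open>This kills the second-order term in the product \<open>W ** W'\<close>.\<close>
  have 3: "D q ** D (g * lam * p) = 0"
  proof -
    have "q * (g * lam * p) = g * lam * (p * q)" by (simp add: mult_ac)
    then show ?thesis by (simp add: D_mult_D pq D_zero)
  qed
  have "W ** W' = V ** V' - V ** D (g * lam * p) ** ?E ** D (q * mu)
      + (D (g * p) ** (?E ** D q ** V')
         - D (g * p) ** ?E ** (D q ** D (g * lam * p)) ** ?E ** D (q * mu))"
    unfolding W_def W'_def
    by (simp add: matrix_mult_add_distrib_right matrix_mult_diff_distrib_left matrix_mul_assoc)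
  then have inv_W: "W ** W' = mat 1"
    by (simp add: 1 2 3 inv matrix_mul_assoc)
  have loc_W: "local_matrix R W" "local_matrix R W'"
    unfolding W_def W'_def
    by (intro local_matrix_add local_matrix_diff local_matrix_D_mult local_matrix_mult_D
        local_matrix_condexp loc R)+
  have row: "W' *v 1 = lam * (1 - g * p * (?E *v (q * mu)))"
    unfolding W'_def
    by (simp add: matrix_vec_mult_diff lam D_mult_vec algebra_simps flip: matrix_vector_mul_assoc)
  \<comment> \<open>\<open>g\<close> is constant on the atoms of \<open>R\<close> and leaves the
    average, while \<open>p * lam\<close> stays inside.\<close>
  have "?E *v (g * lam * p) = g * (?E *v (p * lam))"
    using condexp_mult_measurable[OF R g, of "p * lam"] by (simp add: mult_ac)
  then have col: "1 v* W' = mu * (1 - g * q * (?E *v (p * lam)))"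
    unfolding W'_def
    by (simp add: vec_mult_matrix_diff vec_mult_matrix_assoc mu vec_mult_D
        vec_mult_condexp[OF R] algebra_simps)
  from inv_W loc_W row col show ?thesis
    unfolding partial_inverse_def W_def W'_def by blast
qed

text \<open>Here \<open>condexp R ** W' ** condexp R\<close> equals \<open>D r ** condexp R\<close>,
  so the Neumann series of the perturbation is formally geometric with ratio \<open>- c * r\<close>,
  and its sum contributes the factor \<open>s\<close>. The resulting candidate is checked by direct
  multiplication, so no convergence is involved.\<close>

lemma partial_inverse_update_condexp:
  assumes R: "partition_on UNIV R"
    and partial: "partial_inverse R W W' l m"
    and c: "measurable_vec R c" and s: "measurable_vec R s"
    and El: "condexp R *v l = r" and Em: "condexp R *v m = r"
    and sr: "s * (1 + c * r) = 1"
  shows "partial_inverse R (W + D c ** condexp R) (W' - D (c * s * l) ** condexp R ** D m)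
    (s * l) (s * m)"
proof -
  let ?E = "condexp R"
  define V V' where "V = W + D c ** ?E" and "V' = W' - D (c * s * l) ** ?E ** D m"
  have W: "local_matrix R W" and W': "local_matrix R W'" and inv: "W ** W' = mat 1"
    and l: "W' *v 1 = l" and m: "1 v* W' = m"
    using partial unfolding partial_inverse_def by auto
  have cs: "measurable_vec R (c * s)"
    using measurable_vec_mult[OF c s] .
  have 1: "?E ** W' = ?E ** D m"
    by (simp add: condexp_mult_local_matrix[OF R W'] m)
  have "W ** D (c * s * l) ** ?E = W ** D (c * s) ** (D l ** ?E)"
    by (simp add: D_mult_D matrix_mul_assoc) (simp add: D_mult_D flip: matrix_mul_assoc)
  also have "\<dots> = D (c * s) ** (W ** (D l ** ?E))"
    by (simp add: local_matrix_commute_D[OF W cs] matrix_mul_assoc)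
  also have "D l ** ?E = W' ** ?E"
    by (simp add: local_matrix_mult_condexp[OF R W'] l)
  finally have 2: "W ** D (c * s * l) ** ?E = D (c * s) ** ?E"
    by (simp add: matrix_mul_assoc inv)
  have "?E *v (c * s * l) = c * s * r"
    using condexp_mult_measurable[OF R cs] El by simp
  then have 3: "?E ** D (c * s * l) ** ?E = D (c * s * r) ** ?E"
    by (simp add: condexp_D_condexp[OF R])
  \<comment> \<open>This splitting of \<open>c\<close> makes the first- and second-order terms of
    \<open>V ** V'\<close> cancel.\<close>
  have "c = c * (s * (1 + c * r))" by (simp add: sr)
  also have "\<dots> = c * s + c * (c * s * r)" by (simp add: algebra_simps)
  finally have "D c = D (c * s) + D (c * (c * s * r))" by (simp flip: D_add)
  then have 4: "D c ** ?E ** D m = D (c * s) ** ?E ** D m + D (c * (c * s * r)) ** ?E ** D m"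
    by (simp add: matrix_mult_add_distrib_right)
  have "V ** V' = W ** W' - W ** D (c * s * l) ** ?E ** D m
      + (D c ** (?E ** W') - D c ** (?E ** D (c * s * l) ** ?E) ** D m)"
    unfolding V_def V'_def
    by (simp add: matrix_mult_add_distrib_right matrix_mult_diff_distrib_left matrix_mul_assoc)
  then have inv_V: "V ** V' = mat 1"
    unfolding 1 2 3 inv by (simp add: 4 D_mult_D matrix_mul_assoc)
  have loc_V: "local_matrix R V" "local_matrix R V'"
    unfolding V_def V'_def
    by (intro local_matrix_add local_matrix_diff local_matrix_D_mult local_matrix_mult_D
        local_matrix_condexp W W' R)+
  \<comment> \<open>The same relation simplifies the factor that the update puts on the row and
    column sums.\<close>
  have s1: "1 - c * s * r = s" using sr by (simp add: algebra_simps)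
  have "V' *v 1 = (1 - c * s * r) * l"
    unfolding V'_def
    by (simp add: matrix_vec_mult_diff l D_mult_vec Em algebra_simps flip: matrix_vector_mul_assoc)
  then have row: "V' *v 1 = s * l" by (simp add: s1)
  have "1 v* V' = (1 - c * s * r) * m"
    unfolding V'_def using \<open>?E *v (c * s * l) = c * s * r\<close>
    by (simp add: vec_mult_matrix_diff vec_mult_matrix_assoc m vec_mult_D
        vec_mult_condexp[OF R] algebra_simps)
  then have col: "1 v* V' = s * m" by (simp add: s1)
  from inv_V loc_V row col show ?thesis
    unfolding partial_inverse_def V_def V'_def by blast
qed

section \<open>A criterion for bi-potentials\<close>

lemma bi_potentialI:
  assumes V: "\<And>i j. 0 \<le> V $ i $ j" and inv: "V ** X = mat 1"
    and off: "\<And>i j. i \<noteq> j \<Longrightarrow> X $ i $ j \<le> 0"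
    and row: "\<And>i. 0 \<le> (X *v 1) $ i" and col: "\<And>j. 0 \<le> (1 v* X) $ j"
  shows "bi_potential V" and "matrix_inv V = X"
proof -
  \<comment> \<open>The updates carry only a right inverse; for square matrices it is
    two-sided.\<close>
  have inv': "X ** V = mat 1" using inv matrix_left_right_inverse by blast
  show X: "matrix_inv V = X" using matrix_inv_unique[OF inv inv'] .
  have "0 < X $ i $ i" for i
  proof -
    \<comment> \<open>In the diagonal entry of \<open>X ** V = mat 1\<close> all terms with
      \<open>j \<noteq> i\<close> are nonpositive, so the remaining product of diagonal entries is
      at least 1.\<close>
    have "(\<Sum>j\<in>UNIV. X $ i $ j * V $ j $ i) = 1"
      using inv' by (simp add: vec_eq_iff matrix_matrix_mult_def mat_def)
    then have "1 = X $ i $ i * V $ i $ i + (\<Sum>j\<in>UNIV - {i}. X $ i $ j * V $ j $ i)"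
      by (simp add: sum.remove[of UNIV i])
    also have "(\<Sum>j\<in>UNIV - {i}. X $ i $ j * V $ j $ i) \<le> 0"
      using V off by (intro sum_nonpos) (simp add: mult_nonpos_nonneg)
    finally have "0 < X $ i $ i * V $ i $ i" by simp
    then show ?thesis using V[of i i] by (simp add: zero_less_mult_iff)
  qed
  moreover have "invertible V" unfolding invertible_def using inv inv' by blast
  ultimately show "bi_potential V"
    unfolding bi_potential_def X using V off row col
    by (simp add: matrix_mult_one_nth one_mult_matrix_nth)
qed

text \<open>The atom sizes cancel the normalization of \<open>condexp R\<close>. This is the passage
  from the factors \<open>C s\<close> and \<open>\<Gamma> s\<close> to \<open>c s\<close> and
  \<open>\<gamma> s\<close>.\<close>

lemma D_mult_condexp:
  assumes "partition_on UNIV R"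
  shows "D (a * (F R *v 1)) ** condexp R = D a ** F R"
  using F_one_nonzero[OF assms] by (simp add: vec_eq_iff D_mult_nth condexp_nth[OF assms])

lemma times_vec_nonneg: "0 \<le> a \<Longrightarrow> 0 \<le> b \<Longrightarrow> 0 \<le> a * (b :: real^'n)"
  by (simp add: less_eq_vec_def)

section \<open>The backward recursion over the reals\<close>

lemma filtrationD:
  assumes "filtration k R"
  shows "s \<le> k \<Longrightarrow> partition_on UNIV (R s)" and "s < k \<Longrightarrow> coarser (R s) (R (Suc s))"
  using assms unfolding filtration_def by auto

text \<open>The recursion freed from infinite values: \<open>g\<close> stands for \<gamma>,
  \<open>r\<close> for 1 / d, \<open>w\<close> for 1 / (c + d) and \<open>s\<close> for \<sigma>.
  The relation between \<open>w\<close>, \<open>s\<close> and \<open>r\<close> is 1 / (c + d) = (1 /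
  d) / (1 + c / d). In \<open>g_bound\<close> the bound on \<rho>\<gamma> is multiplied by
  \<open>w\<close>, so it stays meaningful where d is infinite.\<close>

locale filtered_recursion =
  fixes k :: nat
    and R :: "nat \<Rightarrow> 'n::finite set set"
    and p q c g r w s l m lam mu :: "nat \<Rightarrow> real^'n"
  assumes filtration: "filtration k R"
    and c: "t \<le> k \<Longrightarrow> 0 \<le> c t \<and> measurable_vec (R t) (c t)"
    and g: "t < k \<Longrightarrow> 0 \<le> g t \<and> measurable_vec (R t) (g t)"
    and pq: "t < k \<Longrightarrow> measurable_partition (R (Suc t)) (p t) (q t)"
    and r_k: "r k = 1"
    and r_nonneg: "t \<le> k \<Longrightarrow> 0 \<le> r t"
    and r_rec: "t < k \<Longrightarrow> r t = condexp (R t) *v w (Suc t)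
          - g t * (condexp (R t) *v (p t * w (Suc t))) * (condexp (R t) *v (q t * w (Suc t)))"
    and s: "t \<le> k \<Longrightarrow> s t * (1 + c t * r t) = 1"
    and w: "t \<le> k \<Longrightarrow> w t = s t * r t"
    and g_bound: "t < k \<Longrightarrow>
          ((condexp (R t) *v p t) * p t + (condexp (R t) *v q t) * q t) * g t * w (Suc t) \<le> 1"
    and start: "l k = 1" "m k = 1" "lam k = 1" "mu k = 1"
    and lam_rec: "t < k \<Longrightarrow> lam t = s (Suc t) * l (Suc t)"
    and l_rec: "t < k \<Longrightarrow> l t = lam t * (1 - g t * p t * (condexp (R t) *v (q t * w (Suc t))))"
    and mu_rec: "t < k \<Longrightarrow> mu t = s (Suc t) * m (Suc t)"
    and m_rec: "t < k \<Longrightarrow> m t = mu t * (1 - g t * q t * (condexp (R t) *v (p t * w (Suc t))))"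
begin

lemmas partition = filtrationD(1)[OF filtration]
lemmas coarser = filtrationD(2)[OF filtration]

lemma pq_simps:
  assumes "t < k"
  shows "p t $ i \<in> {0, 1}" "q t $ i \<in> {0, 1}" "p t * q t = 0"
    "measurable_vec (R (Suc t)) (p t)" "measurable_vec (R (Suc t)) (q t)"
  using pq[OF assms] unfolding measurable_partition_def by auto

lemma pq_nth_mult: "t < k \<Longrightarrow> p t $ i * q t $ i = 0"
  using pq_simps(3)[of t] by (metis vector_mult_component zero_index)

lemma s_eq: "t \<le> k \<Longrightarrow> s t $ i = 1 / (1 + c t $ i * r t $ i)"
proof -
  assume t: "t \<le> k"
  then have "s t $ i * (1 + c t $ i * r t $ i) = 1"
    using s[OF t] by (metis one_index vector_add_component vector_mult_component)
  then show ?thesis by (metis eq_divide_imp mult_zero_right zero_neq_one)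
qed

lemma s_pos: "t \<le> k \<Longrightarrow> 0 < s t $ i"
  using c[of t] r_nonneg[of t] by (simp add: s_eq less_eq_vec_def add_pos_nonneg)

lemma s_nonneg: "t \<le> k \<Longrightarrow> 0 \<le> s t"
  using s_pos[of t] by (simp add: less_eq_vec_def less_imp_le)

lemma measurable_r: "t \<le> k \<Longrightarrow> measurable_vec (R t) (r t)"
proof (cases "t = k")
  case True
  then show ?thesis by (simp add: r_k measurable_vec_def)
next
  case False
  assume "t \<le> k"
  with False have t: "t < k" by simp
  let ?f = "condexp (R t) *v w (Suc t)"
    and ?h = "g t * (condexp (R t) *v (p t * w (Suc t))) * (condexp (R t) *v (q t * w (Suc t)))"
  have f: "measurable_vec (R t) ?f"
    using t by (intro measurable_vec_condexp partition) simp
  have h: "measurable_vec (R t) ?h"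
    using t g by (intro measurable_vec_mult measurable_vec_condexp partition) simp_all
  show ?thesis
  proof (rule measurable_vecI)
    fix A i j assume A: "A \<in> R t" "i \<in> A" "j \<in> A"
    then show "r t $ i = r t $ j"
      unfolding r_rec[OF t] vector_minus_component
      using measurable_vecD[OF f A] measurable_vecD[OF h A] by (simp only:)
  qed
qed

lemma measurable_s: "t \<le> k \<Longrightarrow> measurable_vec (R t) (s t)"
proof (rule measurable_vecI)
  fix A i j assume "t \<le> k" and A: "A \<in> R t" "i \<in> A" "j \<in> A"
  then show "s t $ i = s t $ j"
    using measurable_vecD[OF measurable_r A] measurable_vecD[OF conjunct2[OF c] A]
    by (simp add: s_eq)
qed

text \<open>Where \<open>q t\<close> is 1, \<open>p t\<close> is 0, so the first factor in
  \<open>g_bound\<close> reduces to the average of \<open>q t\<close>, and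
  \<open>condexp_indicator_mult_le_one\<close> applies; likewise with the roles exchanged.\<close>

lemma g_condexp_le_one:
  assumes t: "t < k"
  shows "g t $ i * (condexp (R t) *v (q t * w (Suc t))) $ i \<le> 1"
    and "g t $ i * (condexp (R t) *v (p t * w (Suc t))) $ i \<le> 1"
proof -
  have *: "((condexp (R t) *v p t) $ j * p t $ j + (condexp (R t) *v q t) $ j * q t $ j) * g t $ j * w (Suc t) $ j \<le> 1" for j
    using g_bound[OF t] by (simp add: less_eq_vec_def)
  have R: "partition_on UNIV (R t)" and gm: "measurable_vec (R t) (g t)"
    using t partition g by simp_all
  show "g t $ i * (condexp (R t) *v (q t * w (Suc t))) $ i \<le> 1"
  proof (rule condexp_indicator_mult_le_one[OF R gm pq_simps(2)[OF t]])
    fix j assume "q t $ j = 1"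
    then show "(condexp (R t) *v q t) $ j * g t $ j * w (Suc t) $ j \<le> 1"
      using *[of j] pq_nth_mult[OF t, of j] by simp
  qed
  show "g t $ i * (condexp (R t) *v (p t * w (Suc t))) $ i \<le> 1"
  proof (rule condexp_indicator_mult_le_one[OF R gm pq_simps(1)[OF t]])
    fix j assume "p t $ j = 1"
    then show "(condexp (R t) *v p t) $ j * g t $ j * w (Suc t) $ j \<le> 1"
      using *[of j] pq_nth_mult[OF t, of j] by simp
  qed
qed

text \<open>As \<open>p t\<close> and \<open>q t\<close> take only the values 0 and 1, each
  component of the brackets in \<open>l_rec\<close> and \<open>m_rec\<close> is either 1 or one
  minus a quantity bounded by \<open>g_condexp_le_one\<close>.\<close>

lemma lam_l_mu_m_nonneg: "t \<le> k \<Longrightarrow> 0 \<le> lam t \<and> 0 \<le> l t \<and> 0 \<le> mu t \<and> 0 \<le> m t"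
proof (induction t rule: inc_induct)
  case base
  show ?case by (simp add: start less_eq_vec_def)
next
  case (step t)
  then have t: "t < k" by simp
  have lam: "0 \<le> lam t" "0 \<le> mu t"
    using step t s_nonneg by (auto simp: lam_rec mu_rec intro!: times_vec_nonneg)
  have "0 \<le> 1 - g t $ i * p t $ i * (condexp (R t) *v (q t * w (Suc t))) $ i" for i
    using pq_simps(1)[OF t, of i] g_condexp_le_one(1)[OF t, of i] by auto
  moreover have "0 \<le> 1 - g t $ i * q t $ i * (condexp (R t) *v (p t * w (Suc t))) $ i" for i
    using pq_simps(2)[OF t, of i] g_condexp_le_one(2)[OF t, of i] by auto
  ultimately have "0 \<le> l t" "0 \<le> m t"
    unfolding l_rec[OF t] m_rec[OF t]
    by (intro times_vec_nonneg lam; simp add: less_eq_vec_def)+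
  with lam show ?case by simp
qed

text \<open>Two start indices are needed because at each level the term with \<open>p\<close>,
  \<open>q\<close> is added before the term with \<open>c\<close>: the induction passes from
  \<open>(Suc t, Suc t)\<close> through \<open>(Suc t, t)\<close> to \<open>(t, t)\<close>.\<close>

definition "partial_N t u = (\<Sum>v=t..k. D (c v * s v * l v) ** condexp (R v) ** D (m v))
  + (\<Sum>v=u..<k. D (g v * lam v * p v) ** condexp (R v) ** D (q v * mu v))"

definition "partial_U t u = (\<Sum>v=t..k. D (c v) ** condexp (R v))
  + (\<Sum>v=u..<k. D (g v * p v) ** condexp (R v) ** D (q v))"

text \<open>Kept separate from the induction, since it is applied inside it at level
  \<open>Suc t\<close> and once more after it at level 0.\<close>

lemma partial_inverse_step_c:
  assumes t: "t \<le> k"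
    and inv: "partial_inverse (R t) (mat 1 + partial_U (Suc t) t) (mat 1 - partial_N (Suc t) t) (l t) (m t)"
    and El: "condexp (R t) *v l t = r t" and Em: "condexp (R t) *v m t = r t"
  shows "partial_inverse (R t) (mat 1 + partial_U t t) (mat 1 - partial_N t t) (s t * l t) (s t * m t)"
proof -
  have U: "mat 1 + partial_U t t = mat 1 + partial_U (Suc t) t + D (c t) ** condexp (R t)"
    using t by (simp add: partial_U_def sum.atLeast_Suc_atMost)
  have N: "mat 1 - partial_N t t = mat 1 - partial_N (Suc t) t - D (c t * s t * l t) ** condexp (R t) ** D (m t)"
    using t by (simp add: partial_N_def sum.atLeast_Suc_atMost)
  show ?thesis
    unfolding U N
    using partial_inverse_update_condexp[OF partition[OF t] inv _ measurable_s[OF t] El Em s[OF t]] c[OF t]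
    by simp
qed

text \<open>The averages of \<open>l t\<close> and \<open>m t\<close> belong to the induction claim
  because the next update, by \<open>c t\<close>, requires both to equal \<open>r t\<close>.\<close>

lemma partial_inverse_l_m:
  "t \<le> k \<Longrightarrow>
    partial_inverse (R t) (mat 1 + partial_U (Suc t) t) (mat 1 - partial_N (Suc t) t) (l t) (m t) \<and>
    condexp (R t) *v l t = r t \<and> condexp (R t) *v m t = r t"
proof (induction t rule: inc_induct)
  case base
  \<comment> \<open>At \<open>t = k\<close> all sums are empty, so both matrices are the
    identity.\<close>
  show ?case
    using partition[of k]
    by (simp add: partial_inverse_def partial_U_def partial_N_def start r_k condexp_one local_matrix_mat)
next
  case (step t)
  then have t: "t < k" and Suc_t: "Suc t \<le> k" and t': "t \<le> k" by simp_all
  let ?E = "condexp (R t)" and ?E' = "condexp (R (Suc t))"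
  note R = partition[OF t'] and Q = partition[OF Suc_t] and RQ = coarser[OF t]
  note gm = conjunct2[OF g[OF t]]
  have inv: "partial_inverse (R (Suc t)) (mat 1 + partial_U (Suc t) (Suc t)) (mat 1 - partial_N (Suc t) (Suc t))
      (lam t) (mu t)"
    using partial_inverse_step_c[OF Suc_t] step.IH by (simp add: lam_rec mu_rec t)
  \<comment> \<open>\<open>s (Suc t)\<close> is measurable at its level and comes out of the
    average, leaving \<open>s (Suc t) * r (Suc t)\<close>, which is
    \<open>w (Suc t)\<close>.\<close>
  have E': "?E' *v lam t = w (Suc t)" "?E' *v mu t = w (Suc t)"
    using step.IH
    by (simp_all add: lam_rec mu_rec t condexp_mult_measurable[OF Q measurable_s[OF Suc_t]] w Suc_t)
  \<comment> \<open>Averaging first over the finer partition replaces \<open>lam t\<close> and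
    \<open>mu t\<close> by their common mean \<open>w (Suc t)\<close>.\<close>
  have tower: "?E *v (a * lam t) = ?E *v (a * w (Suc t))" "?E *v (a * mu t) = ?E *v (a * w (Suc t))"
    if "measurable_vec (R (Suc t)) a" for a
    using condexp_tower[OF R Q RQ, of "a * lam t"] condexp_tower[OF R Q RQ, of "a * mu t"]
    by (simp_all add: condexp_mult_measurable[OF Q that] E')
  have one: "measurable_vec (R (Suc t)) 1" by (simp add: measurable_vec_def)
  note tower_q = tower[OF pq_simps(5)[OF t]] and tower_p = tower[OF pq_simps(4)[OF t]]
  have U: "mat 1 + partial_U (Suc t) t = mat 1 + partial_U (Suc t) (Suc t) + D (g t * p t) ** ?E ** D (q t)"
    using t by (simp add: partial_U_def sum.atLeast_Suc_lessThan)
  have N: "mat 1 - partial_N (Suc t) t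
      = mat 1 - partial_N (Suc t) (Suc t) - D (g t * lam t * p t) ** ?E ** D (q t * mu t)"
    using t by (simp add: partial_N_def sum.atLeast_Suc_lessThan)
  \<comment> \<open>The update produces averages of \<open>q t * mu t\<close> and
    \<open>p t * lam t\<close>, whereas the recursion is stated with \<open>w (Suc t)\<close>;
    \<open>tower\<close> identifies the two.\<close>
  have l: "l t = lam t * (1 - g t * p t * (?E *v (q t * mu t)))"
    and m: "m t = mu t * (1 - g t * q t * (?E *v (p t * lam t)))"
    using t by (simp_all add: l_rec m_rec tower_q tower_p)
  have "partial_inverse (R t) (mat 1 + partial_U (Suc t) t) (mat 1 - partial_N (Suc t) t) (l t) (m t)"
    unfolding U N l m
    by (rule partial_inverse_update_pq[OF R RQ inv pq_simps(4,5,3)[OF t] gm])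
  moreover have "?E *v l t = r t"
  proof -
    have "l t = lam t - g t * (?E *v (q t * w (Suc t))) * (p t * lam t)"
      by (simp add: l_rec t algebra_simps)
    \<comment> \<open>The factor in front is already \<open>R t\<close>-measurable and comes out,
      which leaves the product of two averages occurring in \<open>r_rec\<close>.\<close>
    moreover have "?E *v (g t * (?E *v (q t * w (Suc t))) * (p t * lam t))
        = g t * (?E *v (q t * w (Suc t))) * (?E *v (p t * w (Suc t)))"
      using condexp_mult_measurable[OF R measurable_vec_mult[OF gm measurable_vec_condexp[OF R]]]
      by (simp add: tower_p)
    ultimately show ?thesis
      using tower(1)[OF one] by (simp add: r_rec t matrix_vector_mult_diff_distrib mult_ac)
  qed
  moreover have "?E *v m t = r t"
  proof -
    have "m t = mu t - g t * (?E *v (p t * w (Suc t))) * (q t * mu t)"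
      by (simp add: m_rec t algebra_simps)
    moreover have "?E *v (g t * (?E *v (p t * w (Suc t))) * (q t * mu t))
        = g t * (?E *v (p t * w (Suc t))) * (?E *v (q t * w (Suc t)))"
      using condexp_mult_measurable[OF R measurable_vec_mult[OF gm measurable_vec_condexp[OF R]]]
      by (simp add: tower_q)
    ultimately show ?thesis
      using tower(2)[OF one] by (simp add: r_rec t matrix_vector_mult_diff_distrib mult_ac)
  qed
  ultimately show ?case by simp
qed

lemma partial_U_nonneg: "0 \<le> partial_U 0 0 $ i $ j"
proof -
  have "0 \<le> c v $ i" if "v \<le> k" for v i using c[OF that] by (simp add: less_eq_vec_def)
  moreover have "0 \<le> g v $ i" if "v < k" for v i using g[OF that] by (simp add: less_eq_vec_def)
  moreover have "0 \<le> p v $ i" "0 \<le> q v $ i" if "v < k" for v i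
    using pq_simps(1,2)[OF that, of i] by auto
  ultimately show ?thesis
    using condexp_nonneg[OF partition]
    by (auto simp: partial_U_def D_mult_nth mult_D_nth intro!: add_nonneg_nonneg sum_nonneg mult_nonneg_nonneg)
qed

lemma partial_N_nonneg: "0 \<le> partial_N 0 0 $ i $ j"
proof -
  have "0 \<le> c v $ i" if "v \<le> k" for v i using c[OF that] by (simp add: less_eq_vec_def)
  moreover have "0 \<le> g v $ i" if "v < k" for v i using g[OF that] by (simp add: less_eq_vec_def)
  moreover have "0 \<le> p v $ i" "0 \<le> q v $ i" if "v < k" for v i
    using pq_simps(1,2)[OF that, of i] by auto
  moreover have "0 \<le> lam v $ i" "0 \<le> l v $ i" "0 \<le> mu v $ i" "0 \<le> m v $ i" "0 \<le> s v $ i"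
    if "v \<le> k" for v i
    using lam_l_mu_m_nonneg[OF that] s_nonneg[OF that] by (simp_all add: less_eq_vec_def)
  ultimately show ?thesis
    using condexp_nonneg[OF partition]
    by (auto simp: partial_N_def D_mult_nth mult_D_nth intro!: add_nonneg_nonneg sum_nonneg mult_nonneg_nonneg)
qed

theorem bi_potential_one_plus_partial_U:
  shows "bi_potential (mat 1 + partial_U 0 0)" and "matrix_inv (mat 1 + partial_U 0 0) = mat 1 - partial_N 0 0"
proof -
  \<comment> \<open>The vectors \<open>s 0 * l 0\<close> and \<open>s 0 * m 0\<close> are \<lambda>
    and \<mu> at index -1; their nonnegativity is that of the row and column sums of the
    inverse.\<close>
  have inv: "partial_inverse (R 0) (mat 1 + partial_U 0 0) (mat 1 - partial_N 0 0) (s 0 * l 0) (s 0 * m 0)"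
    using partial_inverse_step_c[of 0] partial_inverse_l_m[of 0] by simp
  have "0 \<le> s 0 * l 0" "0 \<le> s 0 * m 0"
    using lam_l_mu_m_nonneg[of 0] s_nonneg[of 0] by (simp_all add: times_vec_nonneg)
  then have row: "0 \<le> ((mat 1 - partial_N 0 0) *v 1) $ i" and col: "0 \<le> (1 v* (mat 1 - partial_N 0 0)) $ i" for i
    using inv by (simp_all add: partial_inverse_def less_eq_vec_def)
  have 1: "0 \<le> (mat 1 + partial_U 0 0) $ i $ j" for i j
    using partial_U_nonneg[of i j] by (simp add: mat_def)
  have 2: "(mat 1 - partial_N 0 0) $ i $ j \<le> 0" if "i \<noteq> j" for i j
    using partial_N_nonneg[of i j] that by (simp add: mat_def)
  have 3: "(mat 1 + partial_U 0 0) ** (mat 1 - partial_N 0 0) = mat 1"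
    using inv by (simp add: partial_inverse_def)
  show "bi_potential (mat 1 + partial_U 0 0)" "matrix_inv (mat 1 + partial_U 0 0) = mat 1 - partial_N 0 0"
    using bi_potentialI[OF 1 3 2 row col] by simp_all
qed

end

section \<open>From extended real values to the real recursion\<close>

lemma ereal_reciprocal:
  fixes d :: ereal and c :: real
  assumes d: "0 < d" and c: "0 \<le> c"
  defines "r \<equiv> real_of_ereal (1 / d)"
  shows "0 \<le> r" and "1 / d = ereal r"
    and "1 / (ereal c + d) = ereal (r / (1 + c * r))"
    and "1 / (1 + ereal c / d) = ereal (1 / (1 + c * r))"
    and "ereal x \<le> ereal c + d \<Longrightarrow> x * (r / (1 + c * r)) \<le> 1"
proof -
  have "0 \<le> r \<and> 1 / d = ereal r \<and> 1 / (ereal c + d) = ereal (r / (1 + c * r))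
    \<and> 1 / (1 + ereal c / d) = ereal (1 / (1 + c * r))
    \<and> (ereal x \<le> ereal c + d \<longrightarrow> x * (r / (1 + c * r)) \<le> 1)"
  proof (cases d)
    case (real y)
    with d have y: "0 < y" by simp
    then have r: "r = 1 / y" by (simp add: r_def real one_ereal_def)
    have "0 < c + y" "0 < 1 + c / y" "1 + c / y = (c + y) / y"
      using c y by (simp_all add: add_nonneg_pos add_pos_nonneg field_simps)
    with y c show ?thesis
      by (simp add: r real one_ereal_def field_simps)
  next
    \<comment> \<open>Here \<open>r\<close> is 0, so the formulas yield 0 for 1 / (c + d) and 1 for
      \<sigma>, in agreement with the conventions for infinity.\<close>
    case PInf
    then have "r = 0" by (simp add: r_def)
    with PInf show ?thesis by (simp add: zero_ereal_def one_ereal_def)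
  next
    case MInf
    with d show ?thesis by simp
  qed
  then show "0 \<le> r" "1 / d = ereal r" "1 / (ereal c + d) = ereal (r / (1 + c * r))"
    "1 / (1 + ereal c / d) = ereal (1 / (1 + c * r))"
    "ereal x \<le> ereal c + d \<Longrightarrow> x * (r / (1 + c * r)) \<le> 1"
    by blast+
qed

lemma econdexp_ereal:
  assumes "\<And>j. f j = ereal (v $ j)"
  shows "econdexp R f i = ereal ((condexp R *v v) $ i)"
  by (simp add: econdexp_def assms matrix_vector_mult_def)

theorem theorem5p1:
  fixes U :: "real^'n^'n"
    and k :: nat
    and R :: "nat \<Rightarrow> 'n set set"
    and C \<Gamma> p q c \<gamma> \<rho> :: "nat \<Rightarrow> real^'n"
    and d \<sigma> lam l \<mu> m :: "nat \<Rightarrow> 'n \<Rightarrow> ereal"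
    and lam_neg1 \<mu>_neg1 :: "'n \<Rightarrow> ereal"
  assumes filtration: "filtration k R"
    and R_0: "R 0 = {UNIV}"
    and R_k: "R k = range (\<lambda>i. {i})"
    and C: "\<And>s. s \<le> k \<Longrightarrow> 0 \<le> C s \<and> measurable_vec (R s) (C s)"
    and \<Gamma>: "\<And>s. s \<le> k \<Longrightarrow> 0 \<le> \<Gamma> s \<and> measurable_vec (R s) (\<Gamma> s)"
    and \<Gamma>_k: "\<Gamma> k = 0"
    and pq: "\<And>s. s < k \<Longrightarrow> measurable_partition (R (Suc s)) (p s) (q s)"
    and U: "U = (\<Sum>s\<le>k. D (C s) ** F (R s) + D (\<Gamma> s) ** D (p s) ** F (R s) ** D (q s))"
    and c: "\<And>s. s \<le> k \<Longrightarrow> c s = C s * (F (R s) *v 1)"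
    and \<gamma>: "\<And>s. s \<le> k \<Longrightarrow> \<gamma> s = \<Gamma> s * (F (R s) *v 1)"
    and \<rho>: "\<And>s. s < k \<Longrightarrow>
          \<rho> s = (condexp (R s) *v p s) * p s + (condexp (R s) *v q s) * q s"
    and d_nonneg: "\<And>s i. s \<le> k \<Longrightarrow> 0 \<le> d s i"
    and d_k: "\<And>i. d k i = 1"
    and d_rec: "\<And>s i. s < k \<Longrightarrow>
          1 / d s i =
            econdexp (R s) (\<lambda>j. 1 / (ereal (c (Suc s) $ j) + d (Suc s) j)) i
            - ereal (\<gamma> s $ i)
              * econdexp (R s) (\<lambda>j. ereal (p s $ j) / (ereal (c (Suc s) $ j) + d (Suc s) j)) i
              * econdexp (R s) (\<lambda>j. ereal (q s $ j) / (ereal (c (Suc s) $ j) + d (Suc s) j)) i"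
    and \<rho>_\<gamma>: "\<And>s i. s < k \<Longrightarrow>
          ereal (\<rho> s $ i * \<gamma> s $ i) \<le> ereal (c (Suc s) $ i) + d (Suc s) i"
    and \<sigma>: "\<And>s i. s \<le> k \<Longrightarrow> \<sigma> s i = 1 / (1 + ereal (c s $ i) / d s i)"
    and start: "\<And>i. l k i = 1 \<and> m k i = 1 \<and> lam k i = 1 \<and> \<mu> k i = 1"
    and lam_rec: "\<And>s i. s < k \<Longrightarrow> lam s i = \<sigma> (Suc s) i * l (Suc s) i"
    and l_rec: "\<And>s i. s < k \<Longrightarrow>
          l s i = lam s i * (1 - ereal (\<gamma> s $ i) * ereal (p s $ i)
              * econdexp (R s) (\<lambda>j. ereal (q s $ j) / (ereal (c (Suc s) $ j) + d (Suc s) j)) i)"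
    and \<mu>_rec: "\<And>s i. s < k \<Longrightarrow> \<mu> s i = \<sigma> (Suc s) i * m (Suc s) i"
    and m_rec: "\<And>s i. s < k \<Longrightarrow>
          m s i = \<mu> s i * (1 - ereal (\<gamma> s $ i) * ereal (q s $ i)
              * econdexp (R s) (\<lambda>j. ereal (p s $ j) / (ereal (c (Suc s) $ j) + d (Suc s) j)) i)"
    and lam_neg1: "\<And>i. lam_neg1 i = \<sigma> 0 i * l 0 i"
    and \<mu>_neg1: "\<And>i. \<mu>_neg1 i = \<sigma> 0 i * m 0 i"
  shows
    "(\<forall>s\<le>k. \<forall>i. 0 < d s i \<and>
        lam s i \<in> {0..<\<infinity>} \<and> l s i \<in> {0..<\<infinity>} \<and>
        \<mu> s i \<in> {0..<\<infinity>} \<and> m s i \<in> {0..<\<infinity>} \<and> \<sigma> s i \<in> {0..<\<infinity>}) \<and>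
     (\<forall>i. lam_neg1 i \<in> {0..<\<infinity>} \<and> \<mu>_neg1 i \<in> {0..<\<infinity>}) \<and>
     bi_potential (mat 1 + U) \<and>
     matrix_inv (mat 1 + U) = mat 1 -
       ((\<Sum>s\<le>k. D (c s * real_vec (\<sigma> s) * real_vec (l s)) ** condexp (R s)
                  ** D (real_vec (m s)))
        + (\<Sum>s<k. D (\<gamma> s * real_vec (lam s) * p s) ** condexp (R s)
                  ** D (q s * real_vec (\<mu> s))))"
proof -
  \<comment> \<open>\<open>w\<close> is expressed through \<open>r\<close> instead of
    \<open>d\<close>, which keeps it within real arithmetic where \<open>d\<close> is
    infinite.\<close>
  define r w where "r s = (\<chi> i. real_of_ereal (1 / d s i))"
    and "w s = (\<chi> i. r s $ i / (1 + c s $ i * r s $ i))" for s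
  note partition = filtrationD(1)[OF filtration]
  have F_nonneg: "0 \<le> F (R s) *v 1" if "s \<le> k" for s
    using F_one_pos[OF partition[OF that]] by (simp add: less_eq_vec_def less_imp_le)
  have c_vec: "0 \<le> c s \<and> measurable_vec (R s) (c s)" if "s \<le> k" for s
    using C[OF that] F_nonneg[OF that] measurable_vec_F_one[OF partition[OF that]]
    by (simp add: c that times_vec_nonneg measurable_vec_mult)
  have g_vec: "0 \<le> \<gamma> s \<and> measurable_vec (R s) (\<gamma> s)" if "s < k" for s
    using \<Gamma>[of s] F_nonneg[of s] measurable_vec_F_one[OF partition[of s]] that
    by (simp add: \<gamma> times_vec_nonneg measurable_vec_mult)
  have c_nonneg: "0 \<le> c s $ i" if "s \<le> k" for s i
    using c_vec[OF that] by (simp add: less_eq_vec_def)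
  have econdexp_w:
    "econdexp Q (\<lambda>j. 1 / (ereal (c s $ j) + d s j)) i = ereal ((condexp Q *v w s) $ i)"
    "econdexp Q (\<lambda>j. ereal (v $ j) / (ereal (c s $ j) + d s j)) i
      = ereal ((condexp Q *v (v * w s)) $ i)"
    if "s \<le> k" "\<And>i. 0 < d s i" for s i v and Q :: "'n set set"
  proof -
    have *: "1 / (ereal (c s $ j) + d s j) = ereal (w s $ j)" for j
      using ereal_reciprocal(3)[OF that(2) c_nonneg[OF that(1)]] by (simp add: w_def r_def)
    then show "econdexp Q (\<lambda>j. 1 / (ereal (c s $ j) + d s j)) i = ereal ((condexp Q *v w s) $ i)"
      by (rule econdexp_ereal)
    have "ereal (v $ j) / (ereal (c s $ j) + d s j) = ereal ((v * w s) $ j)" for j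
    proof -
      have "ereal (v $ j) / (ereal (c s $ j) + d s j)
          = ereal (v $ j) * (1 / (ereal (c s $ j) + d s j))"
        by (simp add: divide_ereal_def)
      then show ?thesis by (simp add: *)
    qed
    then show "econdexp Q (\<lambda>j. ereal (v $ j) / (ereal (c s $ j) + d s j)) i
      = ereal ((condexp Q *v (v * w s)) $ i)"
      by (rule econdexp_ereal)
  qed
  \<comment> \<open>A zero of \<open>d s\<close> would make \<open>1 / d s i\<close> infinite, but
    positivity at level \<open>Suc s\<close> makes the right side of the recursion finite.\<close>
  have d_pos: "\<forall>i. 0 < d s i" if "s \<le> k" for s
    using that
  proof (induction s rule: inc_induct)
    case base
    show ?case by (simp add: d_k)
  next
    case (step s)
    show ?case
    proof
      fix i
      have "1 / d s i \<noteq> \<infinity>"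
        using step by (simp add: d_rec econdexp_w)
      then have "d s i \<noteq> 0" by (auto simp: divide_ereal_def)
      then show "0 < d s i" using d_nonneg[of s i] step by (simp add: order_less_le)
    qed
  qed
  have d_pos': "0 < d s i" if "s \<le> k" for s i
    using d_pos[OF that] by simp
  note recip = ereal_reciprocal[OF d_pos' c_nonneg]
  \<comment> \<open>Specialized to level \<open>Suc s\<close> with \<open>s < k\<close>, the form in
    which the recursions use it.\<close>
  note econdexp_w = econdexp_w[OF Suc_leI d_pos'[OF Suc_leI]]
  have sig: "\<sigma> s i = ereal (1 / (1 + c s $ i * r s $ i))" if "s \<le> k" for s i
    using recip(4)[OF that that] by (simp add: \<sigma>[OF that] r_def)
  have r_nonneg: "0 \<le> r s $ i" if "s \<le> k" for s i
    using recip(1)[OF that that] by (simp add: r_def)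
  have one_plus_pos: "0 < 1 + c s $ i * r s $ i" if "s \<le> k" for s i
    using c_nonneg[OF that] r_nonneg[OF that] by (simp add: add_pos_nonneg)
  have real_sig: "real_vec (\<sigma> s) $ i = 1 / (1 + c s $ i * r s $ i)" if "s \<le> k" for s i
    by (simp add: real_vec_def sig that)
  \<comment> \<open>\<open>real_of_ereal\<close> sends infinite values to 0, so finiteness has to be
    known before \<open>real_vec\<close> can stand for these functions.\<close>
  have finite: "\<forall>i. lam s i = ereal (real_vec (lam s) $ i) \<and> l s i = ereal (real_vec (l s) $ i)
      \<and> \<mu> s i = ereal (real_vec (\<mu> s) $ i) \<and> m s i = ereal (real_vec (m s) $ i)"
    if "s \<le> k" for s
    using that
  proof (induction s rule: inc_induct)
    case base
    show ?case by (simp add: start real_vec_def)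
  next
    case (step s)
    show ?case
    proof
      fix i
      from step have s: "s < k" by simp
      obtain a b where ab: "l (Suc s) i = ereal a" "m (Suc s) i = ereal b"
        using step.IH by blast
      obtain x where x: "lam s i = ereal x"
        using s by (simp add: lam_rec sig ab)
      obtain y where y: "\<mu> s i = ereal y"
        using s by (simp add: \<mu>_rec sig ab)
      obtain x' where x': "l s i = ereal x'"
        using s by (simp add: l_rec x econdexp_w one_ereal_def)
      obtain y' where y': "m s i = ereal y'"
        using s by (simp add: m_rec y econdexp_w one_ereal_def)
      show "lam s i = ereal (real_vec (lam s) $ i) \<and> l s i = ereal (real_vec (l s) $ i)
        \<and> \<mu> s i = ereal (real_vec (\<mu> s) $ i) \<and> m s i = ereal (real_vec (m s) $ i)"
        by (simp add: real_vec_def x y x' y')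
    qed
  qed
  then have lam_fin: "lam s i = ereal (real_vec (lam s) $ i)"
    and l_fin: "l s i = ereal (real_vec (l s) $ i)"
    and \<mu>_fin: "\<mu> s i = ereal (real_vec (\<mu> s) $ i)"
    and m_fin: "m s i = ereal (real_vec (m s) $ i)" if "s \<le> k" for s i
    using that by blast+
  have sig_fin: "\<sigma> s i = ereal (real_vec (\<sigma> s) $ i)" if "s \<le> k" for s i
    by (simp add: sig real_sig that)
  interpret rec: filtered_recursion k R p q c \<gamma> r w "\<lambda>s. real_vec (\<sigma> s)"
    "\<lambda>s. real_vec (l s)" "\<lambda>s. real_vec (m s)" "\<lambda>s. real_vec (lam s)" "\<lambda>s. real_vec (\<mu> s)"
  proof
    show "filtration k R" by (rule filtration)
    show "0 \<le> c t \<and> measurable_vec (R t) (c t)" if "t \<le> k" for t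
      by (rule c_vec[OF that])
    show "0 \<le> \<gamma> t \<and> measurable_vec (R t) (\<gamma> t)" if "t < k" for t
      by (rule g_vec[OF that])
    show "measurable_partition (R (Suc t)) (p t) (q t)" if "t < k" for t
      by (rule pq[OF that])
    show "r k = 1" by (simp add: vec_eq_iff r_def d_k)
    show "0 \<le> r t" if "t \<le> k" for t
      using r_nonneg[OF that] by (simp add: less_eq_vec_def)
    show "r t = condexp (R t) *v w (Suc t)
      - \<gamma> t * (condexp (R t) *v (p t * w (Suc t))) * (condexp (R t) *v (q t * w (Suc t)))"
      if "t < k" for t
      using that by (simp add: vec_eq_iff r_def[of t] d_rec econdexp_w)
    show "real_vec (\<sigma> t) * (1 + c t * r t) = 1" if "t \<le> k" for t
      using one_plus_pos[OF that] by (simp add: vec_eq_iff real_sig that less_imp_neq[THEN not_sym])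
    show "w t = real_vec (\<sigma> t) * r t" if "t \<le> k" for t
      by (simp add: vec_eq_iff w_def real_sig that)
    \<comment> \<open>The bound on \<rho>\<gamma> multiplied by 1 / (c + d); the last part of
      \<open>ereal_reciprocal\<close> includes the case of infinite \<open>d\<close>.\<close>
    show "((condexp (R t) *v p t) * p t + (condexp (R t) *v q t) * q t) * \<gamma> t * w (Suc t) \<le> 1"
      if "t < k" for t
      using recip(5)[OF _ _ \<rho>_\<gamma>[OF that]] that
      by (simp add: less_eq_vec_def w_def r_def \<rho>)
    show "real_vec (l k) = 1" "real_vec (m k) = 1" "real_vec (lam k) = 1" "real_vec (\<mu> k) = 1"
      by (simp_all add: vec_eq_iff real_vec_def start)
    fix t assume t: "t < k"
    show "real_vec (lam t) = real_vec (\<sigma> (Suc t)) * real_vec (l (Suc t))"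
      using t by (simp add: vec_eq_iff real_vec_def lam_rec)
    show "real_vec (\<mu> t) = real_vec (\<sigma> (Suc t)) * real_vec (m (Suc t))"
      using t by (simp add: vec_eq_iff real_vec_def \<mu>_rec)
    show "real_vec (l t) = real_vec (lam t)
        * (1 - \<gamma> t * p t * (condexp (R t) *v (q t * w (Suc t))))"
      using t by (simp add: vec_eq_iff real_vec_def l_rec econdexp_w one_ereal_def)
    show "real_vec (m t) = real_vec (\<mu> t)
        * (1 - \<gamma> t * q t * (condexp (R t) *v (p t * w (Suc t))))"
      using t by (simp add: vec_eq_iff real_vec_def m_rec econdexp_w one_ereal_def)
  qed
  have fin_nonneg: "0 \<le> real_vec (lam s) $ i" "0 \<le> real_vec (l s) $ i"
    "0 \<le> real_vec (\<mu> s) $ i" "0 \<le> real_vec (m s) $ i" "0 \<le> real_vec (\<sigma> s) $ i"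
    if "s \<le> k" for s i
    using rec.lam_l_mu_m_nonneg[OF that] rec.s_nonneg[OF that] by (simp_all add: less_eq_vec_def)
  have range: "x \<in> {0..<\<infinity>}" if "x = ereal a" "0 \<le> a" for x a
    using that by simp
  have ranges: "lam s i \<in> {0..<\<infinity>} \<and> l s i \<in> {0..<\<infinity>} \<and>
        \<mu> s i \<in> {0..<\<infinity>} \<and> m s i \<in> {0..<\<infinity>} \<and> \<sigma> s i \<in> {0..<\<infinity>}" if "s \<le> k" for s i
    by (intro conjI range[OF lam_fin fin_nonneg(1)] range[OF l_fin fin_nonneg(2)]
        range[OF \<mu>_fin fin_nonneg(3)] range[OF m_fin fin_nonneg(4)] range[OF sig_fin fin_nonneg(5)] that)
  have ranges_neg1: "lam_neg1 i \<in> {0..<\<infinity>} \<and> \<mu>_neg1 i \<in> {0..<\<infinity>}" for i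
  proof
    have "lam_neg1 i = ereal (real_vec (\<sigma> 0) $ i * real_vec (l 0) $ i)"
      by (simp only: lam_neg1 times_ereal.simps(1)[symmetric] l_fin[OF le0, symmetric]
          sig_fin[OF le0, symmetric])
    then show "lam_neg1 i \<in> {0..<\<infinity>}" by (rule range) (simp add: fin_nonneg)
    have "\<mu>_neg1 i = ereal (real_vec (\<sigma> 0) $ i * real_vec (m 0) $ i)"
      by (simp only: \<mu>_neg1 times_ereal.simps(1)[symmetric] m_fin[OF le0, symmetric]
          sig_fin[OF le0, symmetric])
    then show "\<mu>_neg1 i \<in> {0..<\<infinity>}" by (rule range) (simp add: fin_nonneg)
  qed
  have pq_term: "D (\<Gamma> s) ** D (p s) ** F (R s) ** D (q s) = D (\<gamma> s * p s) ** condexp (R s) ** D (q s)"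
    if "s \<le> k" for s
  proof -
    have "D (\<gamma> s * p s) ** condexp (R s) = D (\<Gamma> s * p s) ** F (R s)"
      using D_mult_condexp[OF partition[OF that], of "\<Gamma> s * p s"] by (simp add: \<gamma> that mult_ac)
    then show ?thesis by (simp add: D_mult_D)
  qed
  have "U = (\<Sum>s\<le>k. D (c s) ** condexp (R s)) + (\<Sum>s\<le>k. D (\<gamma> s * p s) ** condexp (R s) ** D (q s))"
    unfolding U sum.distrib[symmetric]
    by (intro sum.cong) (simp_all add: pq_term c D_mult_condexp partition)
  \<comment> \<open>The term at \<open>k\<close> drops out by \<open>\<Gamma>_k\<close>, whatever
    \<open>p k\<close> and \<open>q k\<close> are.\<close>
  also have "(\<Sum>s\<le>k. D (\<gamma> s * p s) ** condexp (R s) ** D (q s))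
      = (\<Sum>s<k. D (\<gamma> s * p s) ** condexp (R s) ** D (q s))"
    by (simp add: \<gamma> \<Gamma>_k D_zero flip: lessThan_Suc_atMost)
  finally have U_eq: "U = rec.partial_U 0 0"
    by (simp add: rec.partial_U_def atMost_atLeast0 lessThan_atLeast0)
  have N_eq: "(\<Sum>s\<le>k. D (c s * real_vec (\<sigma> s) * real_vec (l s)) ** condexp (R s) ** D (real_vec (m s)))
      + (\<Sum>s<k. D (\<gamma> s * real_vec (lam s) * p s) ** condexp (R s) ** D (q s * real_vec (\<mu> s)))
      = rec.partial_N 0 0"
    by (simp add: rec.partial_N_def atMost_atLeast0 lessThan_atLeast0)
  show ?thesis
    unfolding N_eq unfolding U_eq
    using d_pos' ranges ranges_neg1 rec.bi_potential_one_plus_partial_U by blast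
qed

end
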